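(* (a) $(x,y,z)$ is a Pythagorean triple in the Fibonacci model set $\Lambda$ if and only if there exist $l,m,n\in\mathbb{Z}[\tau]$ such that $$x=\pm 2lmn,\qquad y=l(m^2-n^2),\qquad z=l(m^2+n^2)$$ and $\sigma(x),\sigma(y),\sigma(z)\in[-1,\tau-1)$. (b) For each $l,m,n\in\mathbb{Z}[\tau]$ there exists some $N\in\mathbb{Z}$ such that $$x=\pm 2(l\tau^k)mn,\qquad y=(l\tau^k)(m^2-n^2),\qquad z=(l\tau^k)(m^2+n^2)$$ is a Pythagorean triple in the Fibonacci model set $\Lambda$ for all integers $k>N$.
   Context: $\tau=\frac{1+\sqrt5}{2}$, $\tau'=\frac{1-\sqrt5}{2}$, and $\mathbb{Z}[\tau]=\{m+n\tau \mid m,n\in\mathbb{Z}\}$. Since $\tau\tau'=-1$, $\tau$ is a unit of $\mathbb{Z}[\tau]$, so $\tau^k\in\mathbb{Z}[\tau]$ for all $k\in\mathbb{Z}$. The Galois conjugation $\sigma:\mathbb{Z}[\tau]\to\mathbb{Z}[\tau]$ is $\sigma(m+n\tau)=m+n\tau'$ for $m,n\in\mathbb{Z}$. The Fibonacci model set is $\Lambda=\{x\in\mathbb{Z}[\tau] \mid \sigma(x)\in[-1,\tau-1)\}$, the half-open interval being taken in $\mathbb{R}$. A Pythagorean triple in $\Lambda$ is a triple $(x,y,z)$ with $x,y,z\in\Lambda$ and $x^2+y^2=z^2$.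
   Formalization: In (a) the formulas for x and y may be interchanged: as stated (a) fails for the ordered triple (3τ^5, 4τ^5, 5τ^5) in Λ, since 3τ^5 is not divisible by 2 in Z[τ] and so is not ±2lmn. *)

theory Defs
  imports Complex_Main "HOL-Computational_Algebra.Primes"
begin

definition tau :: real  (\<open>\<tau>\<close>)
  where "\<tau> = (1 + sqrt 5) / 2"

definition tau' :: real  (\<open>\<tau>''\<close>)
  where "\<tau>' = (1 - sqrt 5) / 2"

definition Z_tau :: "real set"
  where "Z_tau = {of_int m + of_int n * \<tau> | m n :: int. True}"

text \<open>Galois conjugation. The description operator is meaningful on \<open>Z_tau\<close> only; that it is
  well defined there is the lemma \<open>conj_tau_of_int\<close> below.\<close>

definition conj_tau :: "real \<Rightarrow> real"  (\<open>\<sigma>\<close>)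
  where "\<sigma> x = (THE y. \<exists>m n :: int. x = of_int m + of_int n * \<tau> \<and> y = of_int m + of_int n * \<tau>')"

definition fib_model_set :: "real set"  (\<open>\<Lambda>\<close>)
  where "\<Lambda> = {x \<in> Z_tau. \<sigma> x \<in> {-1..<\<tau> - 1}}"

text \<open>Triples are ordered. In the parametrisation \<open>(2lmn, l(m\<^sup>2 - n\<^sup>2), l(m\<^sup>2 + n\<^sup>2))\<close> the first leg
  is divisible by 2 in \<open>Z_tau\<close>, so it can represent every triple only up to interchanging the
  legs; e.g. \<open>(3\<tau>^5, 4\<tau>^5, 5\<tau>^5)\<close> lies in \<open>\<Lambda>\<close>, and 2 does not divide \<open>3\<tau>^5\<close>.\<close>

definition pythagorean_triple_in :: "real set \<Rightarrow> real \<Rightarrow> real \<Rightarrow> real \<Rightarrow> bool"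
  where "pythagorean_triple_in A x y z \<longleftrightarrow> x \<in> A \<and> y \<in> A \<and> z \<in> A \<and> x\<^sup>2 + y\<^sup>2 = z\<^sup>2"

lemma int_square_eq_5_square:
  fixes c b :: int
  assumes "c\<^sup>2 = 5 * b\<^sup>2"
  shows "b = 0"
proof (rule ccontr)
  assume b: "b \<noteq> 0"
  with assms have c: "c \<noteq> 0" by auto
  have p: "prime_elem (5::int)" by simp
  have "multiplicity 5 (c\<^sup>2) = 2 * multiplicity 5 c"
    using p c by (simp add: prime_elem_multiplicity_power_distrib)
  moreover have "multiplicity 5 (5 * b\<^sup>2) = Suc (2 * multiplicity 5 b)"
    using p b by (simp add: prime_elem_multiplicity_mult_distrib prime_elem_multiplicity_power_distrib)
  ultimately have "2 * multiplicity 5 c = Suc (2 * multiplicity 5 b)"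
    using assms by simp
  thus False by presburger
qed

lemma tau_coords_unique:
  fixes m n m' n' :: int
  assumes "of_int m + of_int n * \<tau> = of_int m' + of_int n' * \<tau>"
  shows "m = m' \<and> n = n'"
proof -
  define a b where "a = m - m'" and "b = n - n'"
  have "real_of_int a + of_int b * \<tau> = 0"
    using assms by (simp add: a_def b_def algebra_simps)
  hence "real_of_int (2 * a + b) = - (of_int b * sqrt 5)"
    by (simp add: tau_def field_simps)
  hence "(real_of_int (2 * a + b))\<^sup>2 = 5 * (real_of_int b)\<^sup>2"
    by (simp add: power_mult_distrib)
  hence "real_of_int ((2 * a + b)\<^sup>2) = real_of_int (5 * b\<^sup>2)" by simp
  hence "(2 * a + b)\<^sup>2 = 5 * b\<^sup>2" by (simp only: of_int_eq_iff)
  hence "b = 0" by (rule int_square_eq_5_square)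
  with \<open>real_of_int a + of_int b * \<tau> = 0\<close> show ?thesis by (simp add: a_def b_def)
qed

lemma conj_tau_of_int: "\<sigma> (of_int m + of_int n * \<tau>) = of_int m + of_int n * \<tau>'"
  unfolding conj_tau_def by (rule the_equality) (auto dest: tau_coords_unique)

end

theory Submission
  imports Defs
begin

text \<open>The ring \<open>Z_tau\<close> is norm-Euclidean and 2 is inert in it, its residue field having four elements.
  Modulo 2, \<open>x\<^sup>2 + y\<^sup>2 = z\<^sup>2\<close> gives \<open>x + y + z \<equiv> 0\<close>; squaring this relation then forces \<open>xy\<close>, hence
  one of the legs, to be divisible by 2. If \<open>x = 2c\<close>, then \<open>a = (z + y) / 2\<close> and \<open>b = (z - y) / 2\<close> lie in \<open>Z_tau\<close>
  and \<open>ab = c\<^sup>2\<close>. Cancelling the gcd of \<open>a\<close> and \<open>c\<close> yields \<open>a = lm\<^sup>2\<close>, \<open>c = lmn\<close>, \<open>b = ln\<^sup>2\<close>.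
  For the second part, \<open>\<sigma> (w\<tau>^k) = \<sigma> w \<tau>'^k\<close> tends to 0, an interior point of the window.\<close>

section \<open>Ring structure of \<open>Z_tau\<close> and its conjugation\<close>

lemma tau_square: "\<tau>\<^sup>2 = \<tau> + 1"
  by (simp add: tau_def power2_eq_square field_simps)

lemma tau'_eq: "\<tau>' = 1 - \<tau>"
  by (simp add: tau_def tau'_def field_simps)

lemma tau_gt_1: "1 < \<tau>"
  by (simp add: tau_def)

lemma abs_tau'_less_1: "\<bar>\<tau>'\<bar> < 1"
  \<comment> \<open>The comparison \<open>sqrt 5 < sqrt 9 = 3\<close> is the bound
    \<open>-1 < \<tau>'\<close>.\<close>
  using real_sqrt_less_mono[of 5 9] by (simp add: tau'_def abs_less_iff)

text \<open>One pair of coordinates serves an element and its conjugate, so identities for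
  \<open>\<sigma>\<close> become integer computations.\<close>

lemma Z_tauE:
  assumes "x \<in> Z_tau"
  obtains m n :: int where "x = of_int m + of_int n * \<tau>" "\<sigma> x = of_int m + of_int n * \<tau>'"
  using assms conj_tau_of_int by (auto simp: Z_tau_def)

lemma Z_tauI: "of_int m + of_int n * \<tau> \<in> Z_tau"
  by (auto simp: Z_tau_def)

lemma
  shows Z_tau_of_int: "of_int k \<in> Z_tau" and conj_tau_of_int': "\<sigma> (of_int k) = of_int k"
  using Z_tauI[of k 0] conj_tau_of_int[of k 0] by simp_all

lemma
  shows Z_tau_tau: "\<tau> \<in> Z_tau" and conj_tau_tau: "\<sigma> \<tau> = \<tau>'"
  using Z_tauI[of 0 1] conj_tau_of_int[of 0 1] by simp_all

lemma
  assumes "x \<in> Z_tau" "y \<in> Z_tau"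
  shows Z_tau_add: "x + y \<in> Z_tau" and conj_tau_add: "\<sigma> (x + y) = \<sigma> x + \<sigma> y"
proof -
  obtain a b where x: "x = of_int a + of_int b * \<tau>" "\<sigma> x = of_int a + of_int b * \<tau>'"
    using assms(1) by (rule Z_tauE)
  obtain c d where y: "y = of_int c + of_int d * \<tau>" "\<sigma> y = of_int c + of_int d * \<tau>'"
    using assms(2) by (rule Z_tauE)
  have "x + y = of_int (a + c) + of_int (b + d) * \<tau>"
    by (simp add: x algebra_simps y)
  then show "x + y \<in> Z_tau" "\<sigma> (x + y) = \<sigma> x + \<sigma> y"
    by (simp_all only: Z_tauI conj_tau_of_int x(2) y(2)) (simp add: algebra_simps)
qed

text \<open>Both \<open>\<tau>\<close> and \<open>\<tau>'\<close> are roots of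
  \<open>t\<^sup>2 = t + 1\<close>. Stated for any such root, one product formula gives closure of
  \<open>Z_tau\<close> under multiplication and, compared at the two roots, multiplicativity of
  \<open>\<sigma>\<close>.\<close>

lemma tau_coords_mult:
  fixes a b c d t :: real
  assumes "t\<^sup>2 = t + 1"
  shows "(a + b * t) * (c + d * t) = (a * c + b * d) + (a * d + b * c + b * d) * t"
proof -
  have "(a + b * t) * (c + d * t) = a * c + (a * d + b * c) * t + b * d * t\<^sup>2"
    by (simp add: algebra_simps power2_eq_square)
  then show ?thesis by (simp add: assms algebra_simps)
qed

lemma tau'_square: "\<tau>'\<^sup>2 = \<tau>' + 1"
  by (simp add: tau'_def power2_eq_square field_simps)

lemma
  assumes "x \<in> Z_tau" "y \<in> Z_tau"
  shows Z_tau_mult: "x * y \<in> Z_tau" and conj_tau_mult: "\<sigma> (x * y) = \<sigma> x * \<sigma> y"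
proof -
  obtain a b where x: "x = of_int a + of_int b * \<tau>" "\<sigma> x = of_int a + of_int b * \<tau>'"
    using assms(1) by (rule Z_tauE)
  obtain c d where y: "y = of_int c + of_int d * \<tau>" "\<sigma> y = of_int c + of_int d * \<tau>'"
    using assms(2) by (rule Z_tauE)
  have "x * y = of_int (a * c + b * d) + of_int (a * d + b * c + b * d) * \<tau>"
    by (simp add: x(1) y(1) tau_coords_mult[OF tau_square])
  then show "x * y \<in> Z_tau" "\<sigma> (x * y) = \<sigma> x * \<sigma> y"
    by (simp_all only: Z_tauI conj_tau_of_int x(2) y(2) tau_coords_mult[OF tau'_square]) simp
qed

lemma
  assumes "x \<in> Z_tau"
  shows Z_tau_minus: "- x \<in> Z_tau" and conj_tau_minus: "\<sigma> (- x) = - \<sigma> x"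
  using Z_tau_mult[OF Z_tau_of_int[of "-1"] assms] conj_tau_mult[OF Z_tau_of_int[of "-1"] assms]
    conj_tau_of_int'[of "-1"] by simp_all

lemma
  assumes "x \<in> Z_tau" "y \<in> Z_tau"
  shows Z_tau_diff: "x - y \<in> Z_tau" and conj_tau_diff: "\<sigma> (x - y) = \<sigma> x - \<sigma> y"
  using Z_tau_add[OF assms(1) Z_tau_minus[OF assms(2)]] conj_tau_add[OF assms(1) Z_tau_minus[OF assms(2)]]
    conj_tau_minus[OF assms(2)] by simp_all

lemma Z_tau_0: "0 \<in> Z_tau" and Z_tau_1: "1 \<in> Z_tau" and Z_tau_2: "2 \<in> Z_tau"
  and conj_tau_1: "\<sigma> 1 = 1"
  using Z_tau_of_int[of 0] Z_tau_of_int[of 1] Z_tau_of_int[of 2] conj_tau_of_int'[of 1] by simp_all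

lemma
  assumes "x \<in> Z_tau"
  shows Z_tau_power: "x ^ k \<in> Z_tau" and conj_tau_power: "\<sigma> (x ^ k) = \<sigma> x ^ k"
proof -
  have "x ^ k \<in> Z_tau \<and> \<sigma> (x ^ k) = \<sigma> x ^ k"
    by (induction k) (auto simp: Z_tau_1 conj_tau_1 assms Z_tau_mult conj_tau_mult)
  then show "x ^ k \<in> Z_tau" "\<sigma> (x ^ k) = \<sigma> x ^ k" by auto
qed

lemmas Z_tau_closed = Z_tau_0 Z_tau_1 Z_tau_2 Z_tau_tau Z_tau_add Z_tau_diff Z_tau_minus Z_tau_mult Z_tau_power

section \<open>The norm \<open>x * \<sigma> x\<close>\<close>

lemma Z_tau_norm:
  "(of_int m + of_int n * \<tau>) * (of_int m + of_int n * \<tau>') = of_int (m\<^sup>2 + m * n - n\<^sup>2)"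
proof -
  have "(of_int m + of_int n * \<tau>) * (of_int m + of_int n * \<tau>')
      = (of_int m)\<^sup>2 + of_int m * of_int n + (of_int n)\<^sup>2 * (\<tau> - \<tau>\<^sup>2)"
    by (simp add: tau'_eq algebra_simps power2_eq_square)
  then show ?thesis by (simp add: tau_square)
qed

text \<open>Integrality makes the absolute norm, which is a real number here, a well-founded measure
  for the Euclidean algorithm.\<close>

lemma Z_tau_norm_int:
  assumes "x \<in> Z_tau"
  obtains k :: int where "x * \<sigma> x = of_int k"
  using assms Z_tau_norm by (metis Z_tauE)

text \<open>Since \<open>\<tau>' = 1 - \<tau>\<close>, the equation \<open>\<sigma> x = 0\<close> is
  itself a relation in the coordinates 1 and \<open>\<tau>\<close>, which are unique.\<close>

lemma conj_tau_nonzero: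
  assumes "x \<in> Z_tau" "x \<noteq> 0"
  shows "\<sigma> x \<noteq> 0"
proof
  assume "\<sigma> x = 0"
  obtain a b where x: "x = of_int a + of_int b * \<tau>" "\<sigma> x = of_int a + of_int b * \<tau>'"
    using assms(1) by (rule Z_tauE)
  have "real_of_int (a + b) + of_int (- b) * \<tau> = of_int 0 + of_int 0 * \<tau>"
    using x(2) \<open>\<sigma> x = 0\<close> by (simp add: tau'_eq algebra_simps)
  from tau_coords_unique[OF this] have "a = 0 \<and> b = 0" by simp
  then show False using x(1) assms(2) by simp
qed

section \<open>Euclidean division, Bezout identity and factorisation\<close>

lemma abs_norm_form_less_1:
  fixes e f :: real
  assumes "\<bar>e\<bar> \<le> 1 / 2" "\<bar>f\<bar> \<le> 1 / 2"
  shows "\<bar>e\<^sup>2 + e * f - f\<^sup>2\<bar> < 1"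
proof -
  have "e\<^sup>2 \<le> 1 / 4" "f\<^sup>2 \<le> 1 / 4"
    using assms power_mono[of "\<bar>e\<bar>" "1 / 2" 2] power_mono[of "\<bar>f\<bar>" "1 / 2" 2]
    by (simp_all add: power_divide)
  moreover have "\<bar>e * f\<bar> \<le> 1 / 2 * (1 / 2)"
    unfolding abs_mult using assms by (intro mult_mono) auto
  moreover have "0 \<le> e\<^sup>2" "0 \<le> f\<^sup>2" by simp_all
  \<comment> \<open>The squares enter with opposite signs, so their difference and the cross term
    each have absolute value at most 1/4.\<close>
  ultimately show ?thesis by linarith
qed

text \<open>The quotient \<open>a / c\<close> equals \<open>a * \<sigma> c\<close> over the integer
  norm of \<open>c\<close>, so it has rational coordinates. Rounding both to nearest integers gives
  \<open>t\<close>; the remainder is \<open>c\<close> times the rounding error, whose norm is below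
  1 in absolute value.\<close>

lemma Z_tau_division:
  assumes a: "a \<in> Z_tau" and c: "c \<in> Z_tau" and "c \<noteq> 0"
  obtains t where "t \<in> Z_tau" "\<bar>(a - c * t) * \<sigma> (a - c * t)\<bar> < \<bar>c * \<sigma> c\<bar>"
proof -
  \<comment> \<open>The relation \<open>\<tau>' = 1 - \<tau>\<close> shows that conjugation maps
    \<open>Z_tau\<close> to itself and is an involution.\<close>
  have cc: "\<sigma> (\<sigma> c) = c" "\<sigma> c \<in> Z_tau"
  proof -
    obtain m n where x: "c = of_int m + of_int n * \<tau>" "\<sigma> c = of_int m + of_int n * \<tau>'"
      using c by (rule Z_tauE)
    have "\<sigma> c = of_int (m + n) + of_int (- n) * \<tau>"
      by (simp add: x(2) tau'_eq algebra_simps)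
    then show "\<sigma> (\<sigma> c) = c" "\<sigma> c \<in> Z_tau"
      by (simp_all only: conj_tau_of_int Z_tauI) (simp add: x(1) tau'_eq algebra_simps)
  qed
  obtain A B where AB: "a * \<sigma> c = of_int A + of_int B * \<tau>" "\<sigma> (a * \<sigma> c) = of_int A + of_int B * \<tau>'"
    using Z_tau_mult[OF a cc(2)] by (rule Z_tauE)
  have AB2: "\<sigma> a * c = of_int A + of_int B * \<tau>'"
    using AB(2) conj_tau_mult[OF a cc(2)] cc(1) by simp
  define D where "D = c * \<sigma> c"
  have D: "D \<noteq> 0" using conj_tau_nonzero[OF c] \<open>c \<noteq> 0\<close> by (simp add: D_def)
  define p q where "p = round (A / D)" and "q = round (B / D)"
  define e f where "e = A / D - p" and "f = B / D - q"
  define t where "t = of_int p + of_int q * \<tau>"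
  have ef: "\<bar>e\<bar> \<le> 1 / 2" "\<bar>f\<bar> \<le> 1 / 2"
    using of_int_round_abs_le[of "A / D"] of_int_round_abs_le[of "B / D"]
    by (simp_all add: e_def f_def p_def q_def abs_minus_commute)
  have t: "t \<in> Z_tau" "\<sigma> t = of_int p + of_int q * \<tau>'"
    by (simp_all only: t_def Z_tauI conj_tau_of_int)
  have AB_ef: "of_int A = D * (e + p)" "of_int B = D * (f + q)"
    using D by (simp_all add: e_def f_def)
  have "a * \<sigma> c = c * \<sigma> c * ((e + p) + (f + q) * \<tau>)"
    unfolding AB(1) AB_ef D_def by (simp add: algebra_simps)
  then have "a = c * ((e + p) + (f + q) * \<tau>)"
    using D by (simp add: D_def)
  then have r: "a - c * t = c * (e + f * \<tau>)"
    by (simp add: t_def algebra_simps)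
  have "\<sigma> a * c = c * \<sigma> c * ((e + p) + (f + q) * \<tau>')"
    unfolding AB2 AB_ef D_def by (simp add: algebra_simps)
  then have "\<sigma> a = \<sigma> c * ((e + p) + (f + q) * \<tau>')"
    using \<open>c \<noteq> 0\<close> by simp
  then have r': "\<sigma> (a - c * t) = \<sigma> c * (e + f * \<tau>')"
    by (simp add: conj_tau_diff conj_tau_mult a c t Z_tau_mult algebra_simps)
  have "(e + f * \<tau>) * (e + f * \<tau>') = e\<^sup>2 + e * f + f\<^sup>2 * (\<tau> - \<tau>\<^sup>2)"
    by (simp add: tau'_eq algebra_simps power2_eq_square)
  then have "(e + f * \<tau>) * (e + f * \<tau>') = e\<^sup>2 + e * f - f\<^sup>2"
    by (simp add: tau_square)
  moreover have "(a - c * t) * \<sigma> (a - c * t) = D * ((e + f * \<tau>) * (e + f * \<tau>'))"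
    unfolding r' unfolding r D_def by (simp only: mult_ac)
  ultimately have "(a - c * t) * \<sigma> (a - c * t) = D * (e\<^sup>2 + e * f - f\<^sup>2)"
    by simp
  moreover have "\<bar>D\<bar> * \<bar>e\<^sup>2 + e * f - f\<^sup>2\<bar> < \<bar>D\<bar> * 1"
    using D abs_norm_form_less_1[OF ef] by (intro mult_strict_left_mono) auto
  ultimately show ?thesis
    using that[OF t(1)] by (simp add: abs_mult D_def)
qed

text \<open>Euclid's algorithm, by induction on the absolute norm of \<open>c\<close>; the floor
  only turns this integer-valued real into an integer. The identity is stated for the cofactors
  \<open>p\<close> and \<open>q\<close>, so their coprimality is available even when
  \<open>g = 0\<close>.\<close>

lemma Z_tau_bezout:
  assumes "a \<in> Z_tau" "c \<in> Z_tau"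
  shows "\<exists>g\<in>Z_tau. \<exists>p\<in>Z_tau. \<exists>q\<in>Z_tau. \<exists>u\<in>Z_tau. \<exists>v\<in>Z_tau.
           a = g * p \<and> c = g * q \<and> u * p + v * q = 1"
  using assms
proof (induction "nat \<bar>\<lfloor>c * \<sigma> c\<rfloor>\<bar>" arbitrary: a c rule: less_induct)
  case less
  show ?case
  proof (cases "c = 0")
    case True
    then show ?thesis
      using less.prems Z_tau_0 Z_tau_1
      by (intro bexI[of _ a] bexI[of _ 1] bexI[of _ 0]) auto
  next
    case False
    obtain t where t: "t \<in> Z_tau" "\<bar>(a - c * t) * \<sigma> (a - c * t)\<bar> < \<bar>c * \<sigma> c\<bar>"
      using Z_tau_division[OF less.prems False] by blast
    have r: "a - c * t \<in> Z_tau" using less.prems t(1) by (intro Z_tau_closed)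
    obtain i j :: int where "(a - c * t) * \<sigma> (a - c * t) = of_int i" "c * \<sigma> c = of_int j"
      using Z_tau_norm_int[OF r] Z_tau_norm_int[OF less.prems(2)] by metis
    then have "nat \<bar>\<lfloor>(a - c * t) * \<sigma> (a - c * t)\<rfloor>\<bar> < nat \<bar>\<lfloor>c * \<sigma> c\<rfloor>\<bar>"
      using t(2) by (simp flip: of_int_abs)
    from less.hyps[OF this less.prems(2) r]
    obtain g p q u v where IH: "g \<in> Z_tau" "p \<in> Z_tau" "q \<in> Z_tau" "u \<in> Z_tau" "v \<in> Z_tau"
      "c = g * p" "a - c * t = g * q" "u * p + v * q = 1" by blast
    \<comment> \<open>Back-substitution through \<open>a = c * t + g * q\<close>.\<close>
    have "a = g * (q + p * t)" "v * (q + p * t) + (u - v * t) * p = 1"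
      using IH(6-8) by (simp_all add: algebra_simps)
    with IH t(1) show ?thesis
      by (intro bexI[of _ g] bexI[of _ "q + p * t"] bexI[of _ p] bexI[of _ v]
          bexI[of _ "u - v * t"] conjI Z_tau_closed)
  qed
qed

text \<open>Cancelling the gcd \<open>g\<close> of \<open>a\<close> and \<open>c\<close> leaves
  \<open>p * b = g * q\<^sup>2\<close> with \<open>p\<close> and \<open>q\<close> coprime. Hence
  \<open>p\<close> divides \<open>g\<close>, and the quotient is \<open>l\<close>, with
  \<open>m = p\<close> and \<open>n = q\<close>. Any unit factor is absorbed in
  \<open>l\<close>.\<close>

lemma Z_tau_mult_eq_square:
  assumes a: "a \<in> Z_tau" and b: "b \<in> Z_tau" and c: "c \<in> Z_tau" and eq: "a * b = c\<^sup>2"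
  shows "\<exists>l\<in>Z_tau. \<exists>m\<in>Z_tau. \<exists>n\<in>Z_tau. a = l * m\<^sup>2 \<and> c = l * m * n \<and> b = l * n\<^sup>2"
proof (cases "a = 0")
  case True
  with eq show ?thesis
    using b Z_tau_0 Z_tau_1 by (intro bexI[of _ b] bexI[of _ 0] bexI[of _ 1]) auto
next
  case False
  obtain g p q u v where gp: "g \<in> Z_tau" "p \<in> Z_tau" "q \<in> Z_tau" "u \<in> Z_tau" "v \<in> Z_tau"
    "a = g * p" "c = g * q" "u * p + v * q = 1"
    using Z_tau_bezout[OF a c] by blast
  have nz: "g \<noteq> 0" "p \<noteq> 0" using False gp(6) by auto
  have pb: "p * b = g * q\<^sup>2"
    using eq nz by (simp add: gp(6,7) power2_eq_square)
  \<comment> \<open>This is \<open>g / p\<close> without a division: expand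
    \<open>g * (u * p + v * q)\<^sup>2 = g\<close>, replace \<open>g * q\<^sup>2\<close> by
    \<open>p * b\<close> and take out the factor \<open>p\<close>.\<close>
  define l where "l = g * (u\<^sup>2 * p + 2 * u * v * q) + v\<^sup>2 * b"
  have l: "l \<in> Z_tau" unfolding l_def using gp b by (intro Z_tau_closed)
  have "p * l = g * (u * p + v * q)\<^sup>2 - v\<^sup>2 * (g * q\<^sup>2) + v\<^sup>2 * (p * b)"
    by (simp add: l_def algebra_simps power2_eq_square)
  then have g: "g = p * l" by (simp add: pb gp(8))
  have "b = l * q\<^sup>2" using pb nz by (simp add: g)
  with l gp(2,3) show ?thesis
    by (intro bexI[of _ l] bexI[of _ p] bexI[of _ q]) (auto simp: gp(6,7) g power2_eq_square)
qed

section \<open>Primality of 2 and Pythagorean triples in \<open>Z_tau\<close>\<close>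

lemma Z_tau_two_prime:
  assumes "a \<in> Z_tau" "b \<in> Z_tau" "w \<in> Z_tau" "a * b = 2 * w"
  shows "(\<exists>v\<in>Z_tau. a = 2 * v) \<or> (\<exists>v\<in>Z_tau. b = 2 * v)"
proof -
  obtain i j where ij: "a = of_int i + of_int j * \<tau>" using assms(1) by (rule Z_tauE)
  obtain k l where kl: "b = of_int k + of_int l * \<tau>" using assms(2) by (rule Z_tauE)
  obtain m n where mn: "w = of_int m + of_int n * \<tau>" using assms(3) by (rule Z_tauE)
  have "of_int (i * k + j * l) + of_int (i * l + j * k + j * l) * \<tau> = of_int (2 * m) + of_int (2 * n) * \<tau>"
    using assms(4) by (simp add: ij kl mn tau_coords_mult[OF tau_square])
  then have "i * k + j * l = 2 * m \<and> i * l + j * k + j * l = 2 * n"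
    by (rule tau_coords_unique)
  then have "even (i * k + j * l)" "even (i * l + j * k + j * l)" by simp_all
  \<comment> \<open>The two parities say that the product vanishes in the residue field with four
    elements, so one factor vanishes there.\<close>
  then have "even i \<and> even j \<or> even k \<and> even l" by auto
  moreover have "\<exists>v\<in>Z_tau. of_int r + of_int s * \<tau> = 2 * v" if even: "even r" "even s" for r s
  proof -
    obtain r' s' where "r = 2 * r'" "s = 2 * s'" using even by (metis evenE)
    then have "of_int r + of_int s * \<tau> = 2 * (of_int r' + of_int s' * \<tau>)" by simp
    then show ?thesis using Z_tauI by blast
  qed
  ultimately show ?thesis unfolding ij kl by blast
qed

lemma Z_tau_pythagorean_even_leg:
  assumes "c \<in> Z_tau" "y \<in> Z_tau" "v \<in> Z_tau" and "(2 * c)\<^sup>2 + y\<^sup>2 = z\<^sup>2" and "2 * c + y + z = 2 * v"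
  shows "\<exists>l\<in>Z_tau. \<exists>m\<in>Z_tau. \<exists>n\<in>Z_tau.
           2 * c = 2 * l * m * n \<and> y = l * (m\<^sup>2 - n\<^sup>2) \<and> z = l * (m\<^sup>2 + n\<^sup>2)"
proof -
  have z: "z = 2 * v - 2 * c - y" using assms(5) by simp
  \<comment> \<open>The factors are \<open>(z + y) / 2\<close> and \<open>(z - y) / 2\<close>,
    written so that they visibly lie in \<open>Z_tau\<close>.\<close>
  have "(v - c) * (v - c - y) = c\<^sup>2"
    using assms(4) unfolding z by (simp add: power2_eq_square algebra_simps)
  then obtain l m n where "l \<in> Z_tau" "m \<in> Z_tau" "n \<in> Z_tau" and
    *: "v - c = l * m\<^sup>2" "c = l * m * n" "v - c - y = l * n\<^sup>2"
    using Z_tau_mult_eq_square[of "v - c" "v - c - y" c] assms(1-3) Z_tau_diff by metis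
  moreover have "y = l * (m\<^sup>2 - n\<^sup>2)" "z = l * (m\<^sup>2 + n\<^sup>2)"
    using *(1,3) z by (simp_all add: algebra_simps)
  ultimately show ?thesis by auto
qed

lemma Z_tau_pythagorean:
  assumes "x \<in> Z_tau" "y \<in> Z_tau" "z \<in> Z_tau" and eq: "x\<^sup>2 + y\<^sup>2 = z\<^sup>2"
  shows "\<exists>l\<in>Z_tau. \<exists>m\<in>Z_tau. \<exists>n\<in>Z_tau.
           (x = 2 * l * m * n \<and> y = l * (m\<^sup>2 - n\<^sup>2) \<or> y = 2 * l * m * n \<and> x = l * (m\<^sup>2 - n\<^sup>2)) \<and>
           z = l * (m\<^sup>2 + n\<^sup>2)"
proof -
  \<comment> \<open>In the expanded square, \<open>x\<^sup>2 + y\<^sup>2 + z\<^sup>2\<close> becomes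
    \<open>2 * z\<^sup>2\<close>. Primality of 2, applied to the square, then makes
    \<open>x + y + z\<close> even.\<close>
  have "(x + y + z) * (x + y + z) = 2 * (z\<^sup>2 + x * y + x * z + y * z)"
    using eq by (simp add: power2_eq_square algebra_simps)
  then obtain v where v: "v \<in> Z_tau" "x + y + z = 2 * v"
    using Z_tau_two_prime[of "x + y + z" "x + y + z" "z\<^sup>2 + x * y + x * z + y * z"] assms(1-3)
    by (auto intro!: Z_tau_closed)
  have "z = 2 * v - x - y" using v(2) by simp
  \<comment> \<open>After substituting for \<open>z\<close>, the squares of the legs cancel and a
    common factor 2 can be divided out, leaving one factor 2 for \<open>x * y\<close>.\<close>
  with eq have "x * y = 2 * (v * (x + y) - v\<^sup>2)"
    by (simp add: power2_eq_square algebra_simps)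
  then consider c where "c \<in> Z_tau" "x = 2 * c" | c where "c \<in> Z_tau" "y = 2 * c"
    using Z_tau_two_prime[of x y "v * (x + y) - v\<^sup>2"] assms(1,2) v(1)
    by (auto intro!: Z_tau_closed)
  then show ?thesis
  proof cases
    case 1
    then show ?thesis
      using Z_tau_pythagorean_even_leg[of c y v z] assms(2) v eq by blast
  next
    case 2
    then show ?thesis
      using Z_tau_pythagorean_even_leg[of c x v z] assms(1) v eq by (auto simp: add.commute add.left_commute)
  qed
qed

section \<open>Scaling by powers of \<open>\<tau>\<close> into the window, and the theorem\<close>

lemma eventually_fib_model_set:
  assumes w: "w \<in> Z_tau"
  shows "\<forall>\<^sub>F k in sequentially. w * \<tau> ^ k \<in> \<Lambda>"
proof -
  have "(\<lambda>k. \<sigma> w * \<tau>' ^ k) \<longlonglongrightarrow> 0"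
    using tendsto_mult_right_zero[OF LIMSEQ_power_zero[of \<tau>']] abs_tau'_less_1 by simp
  \<comment> \<open>Convergence needs an open set around 0, so the left endpoint of the window is
    dropped; 0 lies inside because \<open>\<tau> > 1\<close>.\<close>
  from this have "\<forall>\<^sub>F k in sequentially. \<sigma> w * \<tau>' ^ k \<in> {-1<..<\<tau> - 1}"
    by (rule topological_tendstoD) (use tau_gt_1 in auto)
  then show ?thesis
    by eventually_elim
      (simp add: fib_model_set_def w Z_tau_closed conj_tau_mult conj_tau_power conj_tau_tau)
qed

theorem theorem4p7:
  shows
    "(\<forall>x y z :: real.
        pythagorean_triple_in \<Lambda> x y z \<longleftrightarrow>
        (\<exists>l\<in>Z_tau. \<exists>m\<in>Z_tau. \<exists>n\<in>Z_tau. \<exists>s\<in>{1, -1}.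
           (x = s * (2 * l * m * n) \<and> y = l * (m\<^sup>2 - n\<^sup>2) \<or>
            y = s * (2 * l * m * n) \<and> x = l * (m\<^sup>2 - n\<^sup>2)) \<and>
           z = l * (m\<^sup>2 + n\<^sup>2) \<and>
           \<sigma> x \<in> {-1..<\<tau> - 1} \<and> \<sigma> y \<in> {-1..<\<tau> - 1} \<and> \<sigma> z \<in> {-1..<\<tau> - 1}))
     \<and>
     (\<forall>l\<in>Z_tau. \<forall>m\<in>Z_tau. \<forall>n\<in>Z_tau. \<exists>N :: int. \<forall>k > N. \<forall>s\<in>{1, -1}.
        pythagorean_triple_in \<Lambda>
          (s * (2 * (l * \<tau> powi k) * m * n))
          ((l * \<tau> powi k) * (m\<^sup>2 - n\<^sup>2))
          ((l * \<tau> powi k) * (m\<^sup>2 + n\<^sup>2)))"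
proof (intro conjI allI ballI)
  fix x y z
  show "pythagorean_triple_in \<Lambda> x y z \<longleftrightarrow>
        (\<exists>l\<in>Z_tau. \<exists>m\<in>Z_tau. \<exists>n\<in>Z_tau. \<exists>s\<in>{1, -1}.
           (x = s * (2 * l * m * n) \<and> y = l * (m\<^sup>2 - n\<^sup>2) \<or>
            y = s * (2 * l * m * n) \<and> x = l * (m\<^sup>2 - n\<^sup>2)) \<and>
           z = l * (m\<^sup>2 + n\<^sup>2) \<and>
           \<sigma> x \<in> {-1..<\<tau> - 1} \<and> \<sigma> y \<in> {-1..<\<tau> - 1} \<and> \<sigma> z \<in> {-1..<\<tau> - 1})"
    (is "?L \<longleftrightarrow> ?R")
  proof
    assume L: ?L
    then have "x \<in> Z_tau" "y \<in> Z_tau" "z \<in> Z_tau" "x\<^sup>2 + y\<^sup>2 = z\<^sup>2"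
      and "\<sigma> x \<in> {-1..<\<tau> - 1} \<and> \<sigma> y \<in> {-1..<\<tau> - 1} \<and> \<sigma> z \<in> {-1..<\<tau> - 1}"
      by (simp_all add: pythagorean_triple_in_def fib_model_set_def)
    \<comment> \<open>The parametrisation comes with positive sign, so the witness is
      \<open>s = 1\<close>.\<close>
    with Z_tau_pythagorean[of x y z] show ?R by (metis insertI1 mult_1)
  next
    assume ?R
    then obtain l m n s where lmn: "l \<in> Z_tau" "m \<in> Z_tau" "n \<in> Z_tau" and s: "s = 1 \<or> s = -1"
      and xy: "x = s * (2 * l * m * n) \<and> y = l * (m\<^sup>2 - n\<^sup>2) \<or>
               y = s * (2 * l * m * n) \<and> x = l * (m\<^sup>2 - n\<^sup>2)"
      and z: "z = l * (m\<^sup>2 + n\<^sup>2)"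
      and \<sigma>: "\<sigma> x \<in> {-1..<\<tau> - 1}" "\<sigma> y \<in> {-1..<\<tau> - 1}" "\<sigma> z \<in> {-1..<\<tau> - 1}"
      by blast
    have "x \<in> Z_tau" "y \<in> Z_tau" "z \<in> Z_tau"
      using xy s lmn by (auto simp: z intro!: Z_tau_closed)
    moreover have "(s * (2 * l * m * n))\<^sup>2 + (l * (m\<^sup>2 - n\<^sup>2))\<^sup>2 = z\<^sup>2"
      using s by (auto simp: z power2_eq_square algebra_simps)
    then have "x\<^sup>2 + y\<^sup>2 = z\<^sup>2"
      using xy by (auto simp: add.commute)
    ultimately show ?L
      using \<sigma> by (simp add: pythagorean_triple_in_def fib_model_set_def)
  qed
next
  fix l m n assume lmn: "l \<in> Z_tau" "m \<in> Z_tau" "n \<in> Z_tau"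
  \<comment> \<open>The window is not symmetric about 0, so each sign of the even leg needs its own
    membership.\<close>
  have "\<forall>\<^sub>F k in sequentially. 2 * l * m * n * \<tau> ^ k \<in> \<Lambda> \<and> - (2 * l * m * n) * \<tau> ^ k \<in> \<Lambda> \<and>
          l * (m\<^sup>2 - n\<^sup>2) * \<tau> ^ k \<in> \<Lambda> \<and> l * (m\<^sup>2 + n\<^sup>2) * \<tau> ^ k \<in> \<Lambda>"
    by (intro eventually_conj eventually_fib_model_set Z_tau_closed lmn)
  then obtain K where K: "2 * l * m * n * \<tau> ^ k \<in> \<Lambda>" "- (2 * l * m * n) * \<tau> ^ k \<in> \<Lambda>"
    "l * (m\<^sup>2 - n\<^sup>2) * \<tau> ^ k \<in> \<Lambda>" "l * (m\<^sup>2 + n\<^sup>2) * \<tau> ^ k \<in> \<Lambda>" if "k \<ge> K" for k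
    by (auto simp: eventually_sequentially)
  show "\<exists>N :: int. \<forall>k > N. \<forall>s\<in>{1, -1}.
        pythagorean_triple_in \<Lambda>
          (s * (2 * (l * \<tau> powi k) * m * n))
          ((l * \<tau> powi k) * (m\<^sup>2 - n\<^sup>2))
          ((l * \<tau> powi k) * (m\<^sup>2 + n\<^sup>2))"
  \<comment> \<open>The bound \<open>int K\<close> is nonnegative, so for larger \<open>k\<close>
    the integer power is an ordinary power.\<close>
  proof (intro exI[of _ "int K"] allI impI ballI)
    fix k s assume k: "k > int K" and s: "s \<in> {1, -1 :: real}"
    have powi: "\<tau> powi k = \<tau> ^ nat k" using k by (simp add: power_int_def)
    have "nat k \<ge> K" using k by simp
    note K = K[OF this]
    have "s * (2 * (l * \<tau> powi k) * m * n) \<in> \<Lambda>"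
      using s K(1,2) by (auto simp: powi mult_ac)
    moreover have "(l * \<tau> powi k) * (m\<^sup>2 - n\<^sup>2) \<in> \<Lambda>" "(l * \<tau> powi k) * (m\<^sup>2 + n\<^sup>2) \<in> \<Lambda>"
      using K(3,4) by (simp_all add: powi mult_ac)
    moreover have "(s * (2 * (l * \<tau> powi k) * m * n))\<^sup>2 + ((l * \<tau> powi k) * (m\<^sup>2 - n\<^sup>2))\<^sup>2
        = ((l * \<tau> powi k) * (m\<^sup>2 + n\<^sup>2))\<^sup>2"
      using s by (auto simp: power2_eq_square algebra_simps)
    ultimately show "pythagorean_triple_in \<Lambda>
          (s * (2 * (l * \<tau> powi k) * m * n))
          ((l * \<tau> powi k) * (m\<^sup>2 - n\<^sup>2))
          ((l * \<tau> powi k) * (m\<^sup>2 + n\<^sup>2))"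
      by (simp add: pythagorean_triple_in_def)
  qed
qed

end
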